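(* For every integer $n\ge1$, the variance of the number $C_n$ of comparisons in the dual-pivot Quicksort algorithm is $$\mathrm{var}[C_n]=n(7n+13)-2(n+1)H_1(n)-4(n+1)^2H_2(n).$$
   Context: $H_k(n)=\sum_{i=1}^n\frac1{i^k}$. Dual-pivot Quicksort on a list of $n\ge2$ distinct elements: two pivots are chosen uniformly at random and sorted using one comparison, say $p_1<p_2$; every other element is first compared with $p_1$, and if it is larger than $p_1$ it is also compared with $p_2$; this splits the non-pivot elements into those smaller than $p_1$, those between $p_1$ and $p_2$, and those larger than $p_2$, and the algorithm is applied recursively to the three sublists. Lists of length at most $1$ need no comparisons. $C_n$ is the total number of comparisons. Formally, its probability generating function $P_n(t)$ is determined by $P_0(t)=P_1(t)=1$, $P_2(t)=t$ and, for $n\ge3$, $P_n(t)=\frac1{\binom n2}\sum_{j=2}^n\sum_{i=1}^{j-1}P_{i-1}(t)P_{j-i-1}(t)P_{n-j}(t)\,t^{2n-i-2}$. *)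

theory Defs
  imports "HOL-Probability.Probability"
begin

definition harmonic :: "nat \<Rightarrow> nat \<Rightarrow> real" where
  "harmonic k n = (\<Sum>i=1..n. 1 / real i ^ k)"

text \<open>Number of comparisons spent on classifying the non-pivot elements \<open>xs\<close>: each one is compared
  with the smaller pivot \<open>p\<close>, and only if it is not smaller than \<open>p\<close> also with the larger pivot.\<close>

definition partition_comparisons :: "'a::linorder \<Rightarrow> 'a list \<Rightarrow> nat" where
  "partition_comparisons p xs = (\<Sum>x\<leftarrow>xs. if x < p then 1 else 2)"

lemma bind_pmf_fundef_cong [fundef_cong]:
  "p = q \<Longrightarrow> (\<And>x. x \<in> set_pmf q \<Longrightarrow> f x = g x) \<Longrightarrow> bind_pmf p f = bind_pmf q g"
  by (rule bind_pmf_cong)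

text \<open>Position pairs \<open>a < b\<close> represent the two-element sets of positions, so that the pivots are
  chosen uniformly among all unordered pairs.\<close>

definition pivot_positions :: "'a list \<Rightarrow> (nat \<times> nat) set" where
  "pivot_positions xs = {(a, b). a < b \<and> b < length xs}"

lemma finite_pivot_positions: "finite (pivot_positions xs)"
  by (rule finite_subset[of _ "{..<length xs} \<times> {..<length xs}"])
     (auto simp: pivot_positions_def)

lemma pivot_positions_nonempty: "length xs > 1 \<Longrightarrow> pivot_positions xs \<noteq> {}"
proof -
  assume "length xs > 1"
  then have "(0, 1) \<in> pivot_positions xs" by (simp add: pivot_positions_def)
  then show ?thesis by blast
qed

lemma length_nths_pivots:
  assumes "(a, b) \<in> pivot_positions xs"
  shows "length (nths xs (- {a, b})) < length xs"
proof -
  have "card {i. i < length xs \<and> i \<in> - {a, b}} < card {..<length xs}"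
    using assms by (intro psubset_card_mono) (auto simp: pivot_positions_def)
  then show ?thesis by (simp add: length_nths)
qed

text \<open>The distribution of the number of comparisons of dual-pivot Quicksort on a given list. The
  recursive calls draw their pivots independently. The first summand \<open>1\<close> is the comparison that
  sorts the two pivots.\<close>

function dual_pivot_comparisons :: "'a::linorder list \<Rightarrow> nat pmf" where
  "dual_pivot_comparisons xs =
     (if length xs \<le> 1 then return_pmf 0
      else do {
        (a, b) \<leftarrow> pmf_of_set (pivot_positions xs);
        let p = min (xs ! a) (xs ! b);
        let q = max (xs ! a) (xs ! b);
        let rest = nths xs (- {a, b});
        c1 \<leftarrow> dual_pivot_comparisons (filter (\<lambda>x. x < p) rest);
        c2 \<leftarrow> dual_pivot_comparisons (filter (\<lambda>x. p \<le> x \<and> x \<le> q) rest);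
        c3 \<leftarrow> dual_pivot_comparisons (filter (\<lambda>x. q < x) rest);
        return_pmf (1 + partition_comparisons p rest + c1 + c2 + c3)
      })"
  by auto
termination
  by (relation "Wellfounded.measure length")
     (auto simp: set_pmf_of_set finite_pivot_positions pivot_positions_nonempty
           intro!: le_less_trans[OF length_filter_le length_nths_pivots])

declare dual_pivot_comparisons.simps [simp del]

end

theory Submission
  imports Defs "HOL-Computational_Algebra.Formal_Power_Series"
begin

text \<open>
  The number of comparisons of dual-pivot Quicksort has the same distribution as that of ordinary
  Quicksort, and this is what makes the variance accessible. To see why, run ordinary Quicksort with
  pivot \<open>x\<close> and look at the pivot \<open>y\<close> drawn next among all remaining elements. If \<open>x < y\<close>, then
  every element has been compared with \<open>x\<close> and those larger than \<open>x\<close> also with \<open>y\<close>, exactly as in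
  the dual-pivot partition. If \<open>y < x\<close>, the same happens in the mirror image, which leaves the
  distribution unchanged. Algebraically, one expands one of the two factors of each term in the
  Quicksort recursion for generating functions by the recursion itself, and symmetrises
  (\<open>quicksort_series_dual_pivot\<close>).

  The generating function \<open>E[t\<^sup>C]\<close> is used in the form of its expansion at \<open>t = 1\<close>: with
  \<open>t = 1 + X\<close> it becomes the formal power series whose coefficients are the factorial moments
  \<open>E[C choose k]\<close>. It is multiplicative on independent sums, so that the program yields the
  dual-pivot recursion for it. There the pivots enter only through their ranks, and the pair of
  ranks is uniform over all pairs \<open>i < j < n\<close> (\<open>bij_betw_pivot_ranks\<close>). By induction on the
  length the series is therefore the one of ordinary Quicksort
  (\<open>factorial_moment_series_dual_pivot\<close>).

  What remains is to read off the coefficients of \<open>X\<close> and \<open>X\<^sup>2\<close> in the Quicksort recursion. The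
  linear sums in it telescope. The only nonlinear term is the convolution of the means
  \<open>M\<^sub>n = 2(n+1)H\<^sub>1(n) - 4n\<close> with themselves. The recursion of the means says that their generating
  function \<open>M(x)\<close> satisfies \<open>(1-x) M' = 2M + 2x/(1-x)\<^sup>2\<close>, hence
  \<open>(1-x) (M\<^sup>2)' = 4 M\<^sup>2 + 4x M/(1-x)\<^sup>2\<close>, which is a first-order recurrence for the convolution
  (\<open>quicksort_mean_convolution_Suc\<close>) and allows its closed form to be proved by induction.
\<close>

section \<open>Factorial moment series\<close>

definition factorial_moment_series :: "nat pmf \<Rightarrow> real fps" where
  "factorial_moment_series p =
     Abs_fps (\<lambda>k. measure_pmf.expectation p (\<lambda>c. real (c choose k)))"

lemma factorial_moment_series_nth:
  "fps_nth (factorial_moment_series p) k = measure_pmf.expectation p (\<lambda>c. real (c choose k))"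
  by (simp add: factorial_moment_series_def)

lemma factorial_moment_series_return:
  "factorial_moment_series (return_pmf c) = (1 + fps_X) ^ c"
  by (rule fps_ext)
    (simp add: factorial_moment_series_nth fps_binomial_of_nat [symmetric] binomial_gbinomial)

lemma factorial_moment_series_bind:
  assumes "finite (set_pmf p)" "\<And>a. a \<in> set_pmf p \<Longrightarrow> finite (set_pmf (f a))"
  shows "factorial_moment_series (bind_pmf p f) =
           (\<Sum>a\<in>set_pmf p. fps_const (pmf p a) * factorial_moment_series (f a))"
  using assms
  by (intro fps_ext) (simp add: factorial_moment_series_nth fps_sum_nth
        pmf_expectation_bind [where A = "set_pmf p"])

text \<open>The normalising factor stands on the left so that the recursions can be compared without
  division.\<close>

lemma factorial_moment_series_bind_pmf_of_set:
  assumes "A \<noteq> {}" "finite A" "\<And>a. a \<in> A \<Longrightarrow> finite (set_pmf (f a))"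
  shows "of_nat (card A) * factorial_moment_series (bind_pmf (pmf_of_set A) f) =
           (\<Sum>a\<in>A. factorial_moment_series (f a))"
proof -
  have "card A \<noteq> 0"
    using assms by simp
  have "factorial_moment_series (bind_pmf (pmf_of_set A) f) =
          fps_const (1 / real (card A)) * (\<Sum>a\<in>A. factorial_moment_series (f a))"
    using assms by (subst factorial_moment_series_bind)
      (auto simp: sum_distrib_left set_pmf_of_set pmf_of_set intro!: sum.cong)
  moreover have "of_nat (card A) * fps_const (1 / real (card A)) = 1"
    using \<open>card A \<noteq> 0\<close> by (simp add: fps_of_nat [symmetric])
  ultimately show ?thesis
    by (simp add: mult.assoc [symmetric])
qed

text \<open>This is the multiplicativity on independent sums, in the form that applies to nested binds:
  each further summand \<open>c\<close> contributes \<open>(1 + X)\<^sup>c\<close> under the bind, hence its whole series after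
  it.\<close>

lemma factorial_moment_series_bind_power:
  assumes "finite (set_pmf p)" "\<And>c. finite (set_pmf (f c))"
    and "\<And>c. factorial_moment_series (f c) = G * (1 + fps_X) ^ c"
  shows "factorial_moment_series (bind_pmf p f) = G * factorial_moment_series p"
proof -
  have "factorial_moment_series (bind_pmf p return_pmf) =
          (\<Sum>c\<in>set_pmf p. fps_const (pmf p c) * (1 + fps_X) ^ c)"
    using assms(1) by (subst factorial_moment_series_bind)
      (simp_all add: factorial_moment_series_return)
  then have "factorial_moment_series p =
          (\<Sum>c\<in>set_pmf p. fps_const (pmf p c) * (1 + fps_X) ^ c)"
    by (simp add: bind_return_pmf')
  then show ?thesis
    using assms
    by (simp add: factorial_moment_series_bind sum_distrib_left mult_ac)
qed

lemma factorial_moment_series_sum3: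
  assumes "finite (set_pmf p1)" "finite (set_pmf p2)" "finite (set_pmf p3)"
  shows "factorial_moment_series (do {
             c1 \<leftarrow> p1; c2 \<leftarrow> p2; c3 \<leftarrow> p3; return_pmf (m + c1 + c2 + c3)}) =
           (1 + fps_X) ^ m * factorial_moment_series p1 * factorial_moment_series p2
             * factorial_moment_series p3"
proof -
  have 3: "factorial_moment_series (do {c3 \<leftarrow> p3; return_pmf (m + c1 + c2 + c3)}) =
          (1 + fps_X) ^ (m + c1 + c2) * factorial_moment_series p3" for c1 c2
    using assms
    by (intro factorial_moment_series_bind_power)
      (auto simp: factorial_moment_series_return power_add)
  have 2: "factorial_moment_series
            (do {c2 \<leftarrow> p2; c3 \<leftarrow> p3; return_pmf (m + c1 + c2 + c3)}) =
          ((1 + fps_X) ^ (m + c1) * factorial_moment_series p3) * factorial_moment_series p2"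
    for c1
    using assms by (intro factorial_moment_series_bind_power) (auto simp: 3 power_add mult_ac)
  show ?thesis
    using assms
    by (subst factorial_moment_series_bind_power
          [where G = "(1 + fps_X) ^ m * factorial_moment_series p3 * factorial_moment_series p2"])
      (auto simp: 2 power_add mult_ac)
qed

text \<open>Finite support serves only to make all moments exist; then \<open>c\<^sup>2 = 2 (c choose 2) + c\<close>.\<close>

lemma variance_factorial_moment_series:
  assumes "finite (set_pmf p)"
  shows "measure_pmf.variance p real =
           2 * fps_nth (factorial_moment_series p) 2 + fps_nth (factorial_moment_series p) 1
             - (fps_nth (factorial_moment_series p) 1)\<^sup>2"
proof -
  have integrable: "integrable (measure_pmf p) f" for f :: "nat \<Rightarrow> real"
    using assms by (rule integrable_measure_pmf_finite)
  have square: "(real c)\<^sup>2 = 2 * real (c choose 2) + real c" for c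
    by (cases c) (auto simp: choose_two real_of_nat_div power2_eq_square algebra_simps)
  have "measure_pmf.variance p real =
          measure_pmf.expectation p (\<lambda>c. (real c)\<^sup>2) - (measure_pmf.expectation p real)\<^sup>2"
    by (rule measure_pmf.variance_eq) (rule integrable)+
  also have "measure_pmf.expectation p (\<lambda>c. (real c)\<^sup>2) =
      2 * measure_pmf.expectation p (\<lambda>c. real (c choose 2)) + measure_pmf.expectation p real"
    by (simp add: square integrable)
  finally show ?thesis
    by (simp add: factorial_moment_series_nth)
qed


section \<open>Ordinary Quicksort and the expansion of its second pivot\<close>

text \<open>This is the probability generating function of ordinary Quicksort at \<open>1 + X\<close>: the pivot of
  rank \<open>k\<close> costs \<open>n - 1\<close> comparisons and leaves sublists of lengths \<open>k\<close> and \<open>n - 1 - k\<close>.\<close>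

function quicksort_series :: "nat \<Rightarrow> real fps" where
  "quicksort_series n =
     (if n = 0 then 1
      else fps_const (1 / real n) * (\<Sum>k<n. (1 + fps_X) ^ (n - 1)
             * quicksort_series k * quicksort_series (n - 1 - k)))"
  by auto
termination by (relation "Wellfounded.measure id") auto

declare quicksort_series.simps [simp del]

lemma quicksort_series_0 [simp]: "quicksort_series 0 = 1"
  by (simp add: quicksort_series.simps)

lemma quicksort_series_rec:
  "of_nat n * quicksort_series n =
     (\<Sum>k<n. (1 + fps_X) ^ (n - 1) * quicksort_series k * quicksort_series (n - 1 - k))"
proof (cases "n = 0")
  case False
  have "of_nat n * fps_const (1 / real n) = 1"
    using False by (simp add: fps_of_nat [symmetric])
  then show ?thesis
    using False by (subst quicksort_series.simps) (simp add: mult.assoc [symmetric])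
qed simp

lemma quicksort_series_1 [simp]: "quicksort_series (Suc 0) = 1"
  using quicksort_series_rec [of "Suc 0"] by simp

lemma sum_less_pairs:
  fixes f :: "nat \<Rightarrow> nat \<Rightarrow> 'b::comm_monoid_add"
  shows "(\<Sum>(i, j)\<in>{(i, j). i < j \<and> j < n}. f i j) = (\<Sum>i<n. \<Sum>l<n - 1 - i. f i (i + 1 + l))"
proof -
  have "(\<Sum>(i, j)\<in>{(i, j). i < j \<and> j < n}. f i j) =
          (\<Sum>(i, l)\<in>Sigma {..<n} (\<lambda>i. {..<n - 1 - i}). f i (i + 1 + l))"
    by (rule sum.reindex_bij_witness
          [where i = "\<lambda>(i, l). (i, i + 1 + l)" and j = "\<lambda>(i, j). (i, j - i - 1)"]) auto
  then show ?thesis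
    by (simp add: sum.Sigma)
qed

text \<open>In \<open>n (n - 1) Q\<^sub>n\<close> write the factor \<open>n - 1\<close> inside the sum as \<open>(n - 1 - k) + k\<close>. This counts
  the candidates for the second pivot above and below the first one. The reflection \<open>k \<mapsto> n - 1 - k\<close>
  exchanges the two parts, so only the first one is needed, twice; there \<open>(n - 1 - k) Q\<^bsub>n-1-k\<^esub>\<close>
  is expanded by the recursion. The costs \<open>n - 1\<close> and \<open>n - 2 - k\<close> of the two partitions add up
  to the cost of the dual-pivot partition.\<close>

lemma quicksort_series_dual_pivot:
  "of_nat (n choose 2) * quicksort_series n =
     (\<Sum>(i, j)\<in>{(i, j). i < j \<and> j < n}. (1 + fps_X) ^ (1 + i + 2 * (n - 2 - i))
        * quicksort_series i * quicksort_series (j - i - 1) * quicksort_series (n - 1 - j))"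
proof -
  let ?t = "1 + fps_X :: real fps" and ?Q = quicksort_series
  let ?S = "\<Sum>k<n. ?t ^ (n - 1) * of_nat (n - 1 - k) * ?Q k * ?Q (n - 1 - k)"
  have reflected: "?S = (\<Sum>k<n. ?t ^ (n - 1) * of_nat k * ?Q k * ?Q (n - 1 - k))"
    by (rule sum.reindex_bij_witness [where i = "\<lambda>k. n - 1 - k" and j = "\<lambda>k. n - 1 - k"])
      (auto simp: mult_ac)
  have "of_nat 2 * (of_nat (n choose 2) * ?Q n) = of_nat (n - 1) * (of_nat n * ?Q n)"
  proof -
    have "even (n * (n - 1))"
      by (cases n) auto
    then have "2 * (n choose 2) = (n - 1) * n"
      by (simp add: choose_two mult.commute)
    then show ?thesis
      by (simp only: mult.assoc [symmetric] of_nat_mult [symmetric])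
  qed
  also have "\<dots> = (\<Sum>k<n. ?t ^ (n - 1) * of_nat (n - 1 - k + k) * ?Q k * ?Q (n - 1 - k))"
    unfolding quicksort_series_rec sum_distrib_left
    by (intro sum.cong) (auto simp: mult_ac)
  also have "\<dots> = ?S + (\<Sum>k<n. ?t ^ (n - 1) * of_nat k * ?Q k * ?Q (n - 1 - k))"
    by (simp only: of_nat_add distrib_left distrib_right sum.distrib)
  also have "\<dots> = of_nat 2 * ?S"
    by (simp only: reflected [symmetric] of_nat_numeral mult_2)
  finally have "of_nat (n choose 2) * ?Q n = ?S"
    by (subst (asm) mult_cancel_left) simp
  also have "?S = (\<Sum>k<n. \<Sum>l<n - 1 - k. ?t ^ (1 + k + 2 * (n - 2 - k))
                    * ?Q k * ?Q l * ?Q (n - 1 - (k + 1 + l)))"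
  proof (rule sum.cong [OF refl])
    fix k assume "k \<in> {..<n}"
    have "?t ^ (n - 1) * of_nat (n - 1 - k) * ?Q k * ?Q (n - 1 - k) =
            ?t ^ (n - 1) * ?Q k * (of_nat (n - 1 - k) * ?Q (n - 1 - k))"
      by (simp add: mult_ac)
    also have "\<dots> = (\<Sum>l<n - 1 - k. ?t ^ (n - 1) * ?Q k
                       * (?t ^ (n - 1 - k - 1) * ?Q l * ?Q (n - 1 - k - 1 - l)))"
      by (simp only: quicksort_series_rec sum_distrib_left)
    also have "\<dots> = (\<Sum>l<n - 1 - k. ?t ^ (1 + k + 2 * (n - 2 - k))
                    * ?Q k * ?Q l * ?Q (n - 1 - (k + 1 + l)))"
    proof (rule sum.cong [OF refl])
      fix l assume "l \<in> {..<n - 1 - k}"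
      then have "1 + k + 2 * (n - 2 - k) = n - 1 + (n - 1 - k - 1)"
        and "n - 1 - (k + 1 + l) = n - 1 - k - 1 - l"
        by auto
      then show "?t ^ (n - 1) * ?Q k * (?t ^ (n - 1 - k - 1) * ?Q l * ?Q (n - 1 - k - 1 - l)) =
          ?t ^ (1 + k + 2 * (n - 2 - k)) * ?Q k * ?Q l * ?Q (n - 1 - (k + 1 + l))"
        by (simp only: power_add mult_ac)
    qed
    finally show "?t ^ (n - 1) * of_nat (n - 1 - k) * ?Q k * ?Q (n - 1 - k) = \<dots>" .
  qed
  finally show ?thesis
    by (simp add: sum_less_pairs)
qed


section \<open>Ranks of the pivots\<close>

definition rank_in :: "'a::linorder list \<Rightarrow> 'a \<Rightarrow> nat" where
  "rank_in xs x = card {y \<in> set xs. y < x}"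

lemma rank_in_less_iff:
  assumes "x \<in> set xs" "y \<in> set xs"
  shows "rank_in xs x < rank_in xs y \<longleftrightarrow> x < y"
proof -
  have mono: "rank_in xs x < rank_in xs y" if "x < y" "x \<in> set xs" for x y
    unfolding rank_in_def using that by (intro psubset_card_mono) auto
  show ?thesis
    using mono [of x y] mono [of y x] assms by (cases x y rule: linorder_cases) auto
qed

lemma bij_betw_rank_in: "bij_betw (rank_in xs) (set xs) {..<card (set xs)}"
proof -
  have inj: "inj_on (rank_in xs) (set xs)"
    by (rule inj_onI) (metis rank_in_less_iff less_irrefl linorder_neqE)
  have "rank_in xs x < card (set xs)" if "x \<in> set xs" for x
    unfolding rank_in_def using that by (intro psubset_card_mono) auto
  then have "rank_in xs ` set xs = {..<card (set xs)}"
    using inj by (intro card_subset_eq) (auto simp: card_image)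
  with inj show ?thesis
    by (simp add: bij_betw_def)
qed

text \<open>Passing to ranks turns the positions into a permutation of \<open>{..<length xs}\<close>, and a permutation
  acts bijectively on unordered pairs. This is where distinctness makes the recursion depend on the
  length alone.\<close>

lemma bij_betw_pivot_ranks:
  assumes "distinct xs"
  shows "bij_betw
     (\<lambda>(a, b). (rank_in xs (min (xs ! a) (xs ! b)), rank_in xs (max (xs ! a) (xs ! b))))
     (pivot_positions xs) {(i, j). i < j \<and> j < length xs}"
proof -
  define r where "r = (\<lambda>a. rank_in xs (xs ! a))"
  have r: "bij_betw r {..<length xs} {..<length xs}"
  proof -
    have "bij_betw (rank_in xs \<circ> (!) xs) {..<length xs} {..<length xs}"
      using assms bij_betw_nth [OF assms, of "{..<length xs}" "set xs"]
        bij_betw_rank_in [of xs]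
      by (intro bij_betw_trans) (auto simp: distinct_card)
    then show ?thesis
      by (simp add: r_def comp_def)
  qed
  have r_eq: "r a = r b \<longleftrightarrow> a = b" if "a < length xs" "b < length xs" for a b
    using r that by (auto simp: bij_betw_def inj_on_def)
  have r_less: "r a < length xs" if "a < length xs" for a
    using r that by (auto simp: bij_betw_def)
  have minmax: "rank_in xs (min (xs ! a) (xs ! b)) = min (r a) (r b)"
      "rank_in xs (max (xs ! a) (xs ! b)) = max (r a) (r b)"
    if "a < length xs" "b < length xs" for a b
    using rank_in_less_iff [of "xs ! a" xs "xs ! b"] rank_in_less_iff [of "xs ! b" xs "xs ! a"] that
    by (auto simp: r_def min_def max_def)
  have "bij_betw (\<lambda>(a, b). (min (r a) (r b), max (r a) (r b)))
          (pivot_positions xs) {(i, j). i < j \<and> j < length xs}"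
  proof (rule bij_betwI')
    fix u v assume "u \<in> pivot_positions xs" "v \<in> pivot_positions xs"
    then show "((case u of (a, b) \<Rightarrow> (min (r a) (r b), max (r a) (r b))) =
           (case v of (a, b) \<Rightarrow> (min (r a) (r b), max (r a) (r b)))) = (u = v)"
      by (auto simp: pivot_positions_def min_def max_def r_eq split: if_splits)
  next
    fix u assume "u \<in> pivot_positions xs"
    then obtain a b where "u = (a, b)" "a < b" "b < length xs"
      by (auto simp: pivot_positions_def)
    then show "(case u of (a, b) \<Rightarrow> (min (r a) (r b), max (r a) (r b)))
        \<in> {(i, j). i < j \<and> j < length xs}"
      using r_eq [of a b] r_less [of a] r_less [of b] by (auto simp: min_def max_def)
  next
    fix v assume "v \<in> {(i, j). i < j \<and> j < length xs}"
    then obtain i j where v: "v = (i, j)" "i < j" "j < length xs"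
      by auto
    have "i \<in> r ` {..<length xs}" "j \<in> r ` {..<length xs}"
      using r v by (auto simp: bij_betw_def)
    then obtain a b where ab: "i = r a" "j = r b" "a < length xs" "b < length xs"
      by auto
    then have "a \<noteq> b"
      using v by auto
    then have "(min a b, max a b) \<in> pivot_positions xs"
      using ab by (auto simp: pivot_positions_def min_def max_def)
    then show "\<exists>u\<in>pivot_positions xs.
        v = (case u of (a, b) \<Rightarrow> (min (r a) (r b), max (r a) (r b)))"
      using ab v by (intro bexI [of _ "(min a b, max a b)"]) (auto simp: min_def max_def)
  qed
  then show ?thesis
    by (rule bij_betw_cong [THEN iffD1, rotated]) (auto simp: pivot_positions_def minmax)
qed

lemma card_pivot_positions: "card (pivot_positions xs) = length xs choose 2"
proof -
  have "card (pivot_positions xs) = (\<Sum>(i, j)\<in>{(i, j). i < j \<and> j < length xs}. 1)"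
    by (simp add: pivot_positions_def)
  also have "\<dots> = (\<Sum>i<length xs. length xs - 1 - i)"
    by (simp only: sum_less_pairs) simp
  also have "\<dots> = (\<Sum>i<length xs. i)"
    by (rule sum.reindex_bij_witness
          [where i = "\<lambda>k. length xs - 1 - k" and j = "\<lambda>k. length xs - 1 - k"]) auto
  also have "\<dots> = length xs choose 2"
    by (simp add: choose_two lessThan_atLeast0 Sum_Ico_nat mult.commute)
  finally show ?thesis .
qed

text \<open>The number of small elements is the rank of the lower pivot, because the removed pivots are not
  below it; between the pivots, and above them, the pivots have to be discounted.\<close>

lemma partition_lengths:
  fixes xs :: "'a::linorder list"
  assumes "distinct xs" "(a, b) \<in> pivot_positions xs"
  defines "p \<equiv> min (xs ! a) (xs ! b)" and "q \<equiv> max (xs ! a) (xs ! b)"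
    and "ys \<equiv> nths xs (- {a, b})"
  shows "length (filter (\<lambda>x. x < p) ys) = rank_in xs p"
    and "length (filter (\<lambda>x. p \<le> x \<and> x \<le> q) ys) = rank_in xs q - rank_in xs p - 1"
    and "length (filter (\<lambda>x. q < x) ys) = length xs - 1 - rank_in xs q"
    and "partition_comparisons p ys = rank_in xs p + 2 * (length xs - 2 - rank_in xs p)"
proof -
  have ab: "a < length xs" "b < length xs" "a \<noteq> b"
    using assms by (auto simp: pivot_positions_def)
  have "xs ! a \<noteq> xs ! b"
    using ab assms(1) by (simp add: nth_eq_iff_index_eq)
  then have "p < q"
    by (auto simp: p_def q_def min_def max_def)
  have pq: "p \<in> set xs" "q \<in> set xs"
    using ab by (auto simp: p_def q_def min_def max_def)
  have "{xs ! a, xs ! b} = {p, q}"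
    by (auto simp: p_def q_def min_def max_def)
  moreover have "set ys = set xs - {xs ! a, xs ! b}"
    using ab assms(1) by (auto simp: ys_def set_nths in_set_conv_nth nth_eq_iff_index_eq)
  ultimately have set_ys: "set ys = set xs - {p, q}"
    by simp
  have "distinct ys"
    using assms(1) by (simp add: ys_def)
  have length_filter: "length (filter P ys) = card {x \<in> set xs - {p, q}. P x}" for P
    using \<open>distinct ys\<close> set_ys
    by (metis distinct_card distinct_filter set_filter)
  have length_ys: "length ys = length xs - 2"
    unfolding distinct_card [OF \<open>distinct ys\<close>, symmetric] set_ys
    using pq \<open>p < q\<close> by (simp add: card_Diff_subset distinct_card [OF assms(1)])
  show small: "length (filter (\<lambda>x. x < p) ys) = rank_in xs p"
    unfolding length_filter rank_in_def using \<open>p < q\<close>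
    by (intro arg_cong [where f = card]) auto
  have "rank_in xs q = card (insert p ({x \<in> set xs. x < p} \<union> {x \<in> set xs. p < x \<and> x < q}))"
    unfolding rank_in_def using \<open>p < q\<close> pq by (intro arg_cong [where f = card]) auto
  also have "\<dots> = Suc (rank_in xs p + card {x \<in> set xs. p < x \<and> x < q})"
    unfolding rank_in_def by (subst card_insert_disjoint) (auto intro!: card_Un_disjoint)
  finally have rank_q: "rank_in xs q = Suc (rank_in xs p + card {x \<in> set xs. p < x \<and> x < q})" .
  have "length (filter (\<lambda>x. p \<le> x \<and> x \<le> q) ys) = card {x \<in> set xs. p < x \<and> x < q}"
    unfolding length_filter by (intro arg_cong [where f = card]) auto
  then show "length (filter (\<lambda>x. p \<le> x \<and> x \<le> q) ys) = rank_in xs q - rank_in xs p - 1"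
    using rank_q by simp
  have "length xs = card (insert q ({x \<in> set xs. x < q} \<union> {x \<in> set xs. q < x}))"
    unfolding distinct_card [OF assms(1), symmetric] using pq
    by (intro arg_cong [where f = card]) auto
  also have "\<dots> = Suc (rank_in xs q + card {x \<in> set xs. q < x})"
    unfolding rank_in_def by (subst card_insert_disjoint) (auto intro!: card_Un_disjoint)
  finally have "card {x \<in> set xs. q < x} = length xs - 1 - rank_in xs q"
    by simp
  moreover have "length (filter (\<lambda>x. q < x) ys) = card {x \<in> set xs. q < x}"
    unfolding length_filter using \<open>p < q\<close> by (intro arg_cong [where f = card]) auto
  ultimately show "length (filter (\<lambda>x. q < x) ys) = length xs - 1 - rank_in xs q"
    by simp
  have "partition_comparisons p zs =
          length (filter (\<lambda>x. x < p) zs) + 2 * (length zs - length (filter (\<lambda>x. x < p) zs))" for zs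
  proof (induction zs)
    case (Cons z zs)
    then show ?case
      using length_filter_le [of "\<lambda>x. x < p" zs]
      by (auto simp: partition_comparisons_def Suc_diff_le)
  qed (simp add: partition_comparisons_def)
  from this [of ys] show
    "partition_comparisons p ys = rank_in xs p + 2 * (length xs - 2 - rank_in xs p)"
    by (simp add: small length_ys)
qed


section \<open>Dual-pivot Quicksort\<close>

lemma finite_set_dual_pivot_comparisons:
  fixes xs :: "'a::linorder list"
  shows "finite (set_pmf (dual_pivot_comparisons xs))"
proof (induction xs rule: measure_induct_rule [of length])
  case (less xs)
  show ?case
  proof (cases "length xs \<le> 1")
    case False
    have "finite (set_pmf (dual_pivot_comparisons (filter P (nths xs (- {a, b})))))"
      if "(a, b) \<in> pivot_positions xs" for P a b
      using that by (intro less le_less_trans [OF length_filter_le length_nths_pivots])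
    then show ?thesis
      using False
      by (subst dual_pivot_comparisons.simps)
        (auto simp: Let_def set_pmf_of_set finite_pivot_positions pivot_positions_nonempty)
  qed (simp add: dual_pivot_comparisons.simps)
qed

text \<open>By induction the sublists contribute Quicksort series of their lengths. After reindexing by
  ranks the recursion of the program is the right-hand side of \<open>quicksort_series_dual_pivot\<close>.\<close>

lemma factorial_moment_series_dual_pivot:
  fixes xs :: "'a::linorder list"
  assumes "distinct xs"
  shows "factorial_moment_series (dual_pivot_comparisons xs) = quicksort_series (length xs)"
  using assms
proof (induction xs rule: measure_induct_rule [of length])
  case (less xs)
  let ?n = "length xs"
  let ?F = factorial_moment_series and ?D = dual_pivot_comparisons and ?Q = quicksort_series
  show ?case
  proof (cases "?n \<le> 1")
    case True
    then have "?n = 0 \<or> ?n = Suc 0"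
      by linarith
    then show ?thesis
      by (auto simp: dual_pivot_comparisons.simps factorial_moment_series_return)
  next
    case False
    \<comment> \<open>The parts of the program as functions of the pair of pivot positions, so that the sum over
      these pairs can be reindexed.\<close>
    define p where "p = (\<lambda>(a, b). min (xs ! a) (xs ! b))"
    define q where "q = (\<lambda>(a, b). max (xs ! a) (xs ! b))"
    define ys where "ys = (\<lambda>(a, b). nths xs (- {a, b}))"
    define small where "small = (\<lambda>u. filter (\<lambda>x. x < p u) (ys u))"
    define medium where "medium = (\<lambda>u. filter (\<lambda>x. p u \<le> x \<and> x \<le> q u) (ys u))"
    define large where "large = (\<lambda>u. filter (\<lambda>x. q u < x) (ys u))"
    define body where "body = (\<lambda>u. do {
        c1 \<leftarrow> ?D (small u); c2 \<leftarrow> ?D (medium u); c3 \<leftarrow> ?D (large u);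
        return_pmf (1 + partition_comparisons (p u) (ys u) + c1 + c2 + c3)})"
    have D: "?D xs = bind_pmf (pmf_of_set (pivot_positions xs)) body"
      using False
      by (subst dual_pivot_comparisons.simps)
        (auto simp: body_def small_def medium_def large_def p_def q_def ys_def Let_def
          intro!: bind_pmf_cong)
    define summand where "summand = (\<lambda>i j. (1 + fps_X) ^ (1 + i + 2 * (?n - 2 - i))
        * ?Q i * ?Q (j - i - 1) * ?Q (?n - 1 - j))"
    have body: "?F (body u) = summand (rank_in xs (p u)) (rank_in xs (q u))"
      if u: "u \<in> pivot_positions xs" for u
    proof -
      obtain a b where ab: "u = (a, b)"
        by force
      have length_u: "length (small u) = rank_in xs (p u)"
        "length (medium u) = rank_in xs (q u) - rank_in xs (p u) - 1"
        "length (large u) = ?n - 1 - rank_in xs (q u)"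
        "partition_comparisons (p u) (ys u) =
           rank_in xs (p u) + 2 * (?n - 2 - rank_in xs (p u))"
        using partition_lengths [OF less.prems u [unfolded ab]]
        by (simp_all only: ab small_def medium_def large_def p_def q_def ys_def prod.case)
      have IH: "?F (?D (filter P (ys u))) = ?Q (length (filter P (ys u)))" for P
        using u less.prems
        by (intro less.IH le_less_trans [OF length_filter_le])
          (auto simp: ab ys_def intro!: length_nths_pivots)
      have "?F (body u) = (1 + fps_X) ^ (1 + partition_comparisons (p u) (ys u))
              * ?F (?D (small u)) * ?F (?D (medium u)) * ?F (?D (large u))"
        unfolding body_def
        by (intro factorial_moment_series_sum3 finite_set_dual_pivot_comparisons)
      moreover have "?F (?D (small u)) = ?Q (length (small u))"
        "?F (?D (medium u)) = ?Q (length (medium u))"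
        "?F (?D (large u)) = ?Q (length (large u))"
        using IH by (simp_all add: small_def medium_def large_def)
      ultimately show ?thesis
        by (simp add: length_u summand_def add.assoc)
    qed
    have "of_nat (?n choose 2) * ?F (?D xs) = (\<Sum>u\<in>pivot_positions xs. ?F (body u))"
      unfolding D card_pivot_positions [symmetric] using False
      by (intro factorial_moment_series_bind_pmf_of_set finite_pivot_positions
            pivot_positions_nonempty)
        (auto simp: body_def finite_set_dual_pivot_comparisons)
    also have "\<dots> = (\<Sum>u\<in>pivot_positions xs. case (rank_in xs (p u), rank_in xs (q u)) of
                       (i, j) \<Rightarrow> summand i j)"
      by (intro sum.cong) (auto simp: body)
    also have "\<dots> = (\<Sum>(i, j)\<in>{(i, j). i < j \<and> j < ?n}. summand i j)"
      using bij_betw_pivot_ranks [OF less.prems]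
      by (intro sum.reindex_bij_betw) (simp add: p_def q_def case_prod_unfold)
    also have "\<dots> = of_nat (?n choose 2) * ?Q ?n"
      unfolding quicksort_series_dual_pivot summand_def ..
    finally show ?thesis
      using False by simp
  qed
qed


section \<open>Moments of ordinary Quicksort\<close>

lemma harmonic_0 [simp]: "harmonic k 0 = 0"
  by (simp add: harmonic_def)

lemma harmonic_Suc [simp]: "harmonic k (Suc n) = harmonic k n + 1 / (real n + 1) ^ k"
  by (simp add: harmonic_def add.commute)

definition quicksort_mean :: "nat \<Rightarrow> real" where
  "quicksort_mean n = 2 * (real n + 1) * harmonic 1 n - 4 * real n"

text \<open>The difference of two consecutive instances of the recursion
  \<open>n M\<^sub>n = n (n - 1) + 2 (M\<^sub>0 + \<dots> + M\<^bsub>n-1\<^esub>)\<close>. Since only neighbouring means occur in it, sums of means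
  telescope.\<close>

lemma quicksort_mean_Suc:
  "(real n + 1) * quicksort_mean (Suc n) = (real n + 2) * quicksort_mean n + 2 * real n"
  by (simp add: quicksort_mean_def field_simps)

lemma sum_quicksort_mean:
  "2 * (\<Sum>k<n. quicksort_mean k) = real n * (quicksort_mean n - real n + 1)"
proof (induction n)
  case (Suc n)
  then show ?case
    using quicksort_mean_Suc [of n] by (simp add: algebra_simps)
qed simp

text \<open>This sum is the inhomogeneous term of the recurrence for the convolution below. Its increments
  are the partial sums of the means.\<close>

lemma weighted_sum_quicksort_mean:
  "(\<Sum>k\<le>n. real (n - k) * quicksort_mean k) =
     real n * (real n + 1) * (real n + 2) / 3 * harmonic 1 n
       + real n / 9 - 7 * (real n)\<^sup>2 / 6 - 17 * (real n) ^ 3 / 18"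
proof (induction n)
  case (Suc n)
  have "(\<Sum>k\<le>Suc n. real (Suc n - k) * quicksort_mean k) =
          (\<Sum>k\<le>n. real (n - k) * quicksort_mean k + quicksort_mean k)"
    by (auto intro!: sum.cong simp: of_nat_diff algebra_simps)
  also have "\<dots> = (\<Sum>k\<le>n. real (n - k) * quicksort_mean k)
                   + real (Suc n) * (quicksort_mean (Suc n) - real (Suc n) + 1) / 2"
    using sum_quicksort_mean [of "Suc n"] by (simp add: sum.distrib lessThan_Suc_atMost)
  finally show ?case
    by (simp only: Suc.IH) (simp add: quicksort_mean_def field_simps power2_eq_square power3_eq_cube)
qed (simp add: quicksort_mean_def)

definition quicksort_mean_convolution :: "nat \<Rightarrow> real" where
  "quicksort_mean_convolution n = (\<Sum>k\<le>n. quicksort_mean k * quicksort_mean (n - k))"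

text \<open>The coefficient form of the differential equation for the square of the generating function
  of the means. The derivative corresponds to the weight \<open>n\<close>, which by symmetry may be replaced by
  \<open>2k\<close>; then \<open>quicksort_mean_Suc\<close> applies to the factor with index \<open>k\<close>.\<close>

lemma quicksort_mean_convolution_Suc:
  "(real n + 1) * quicksort_mean_convolution (Suc n) =
     (real n + 4) * quicksort_mean_convolution n + 4 * (\<Sum>k\<le>n. real (n - k) * quicksort_mean k)"
proof -
  let ?M = quicksort_mean
  have reflect: "(\<Sum>k\<le>m. f k * ?M k * ?M (m - k)) = (\<Sum>k\<le>m. f (m - k) * ?M k * ?M (m - k))"
    for m and f :: "nat \<Rightarrow> real"
    by (rule sum.reindex_bij_witness [where i = "\<lambda>k. m - k" and j = "\<lambda>k. m - k"]) auto
  have symmetric: "real m * quicksort_mean_convolution m =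
          2 * (\<Sum>k\<le>m. real k * ?M k * ?M (m - k))" for m
  proof -
    have "real m * quicksort_mean_convolution m =
            (\<Sum>k\<le>m. real k * ?M k * ?M (m - k) + real (m - k) * ?M k * ?M (m - k))"
      unfolding quicksort_mean_convolution_def sum_distrib_left
      by (intro sum.cong) (auto simp: of_nat_diff algebra_simps)
    then show ?thesis
      using reflect [of real m] by (simp add: sum.distrib)
  qed
  have "(real n + 1) * quicksort_mean_convolution (Suc n) =
          2 * (\<Sum>k\<le>Suc n. real k * ?M k * ?M (Suc n - k))"
    using symmetric [of "Suc n"] by (simp add: add.commute)
  also have "(\<Sum>k\<le>Suc n. real k * ?M k * ?M (Suc n - k)) =
          (\<Sum>k\<le>n. ((real k + 1) * ?M (Suc k)) * ?M (n - k))"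
    by (subst sum.atMost_Suc_shift) (simp add: add.commute)
  also have "\<dots> = (\<Sum>k\<le>n. real k * ?M k * ?M (n - k)) + 2 * quicksort_mean_convolution n
                  + 2 * (\<Sum>k\<le>n. real k * ?M (n - k))"
    unfolding quicksort_mean_Suc quicksort_mean_convolution_def
    by (simp add: algebra_simps sum.distrib sum_distrib_left)
  also have "(\<Sum>k\<le>n. real k * ?M (n - k)) = (\<Sum>k\<le>n. real (n - k) * ?M k)"
    by (rule sum.reindex_bij_witness [where i = "\<lambda>k. n - k" and j = "\<lambda>k. n - k"]) auto
  finally show ?thesis
    using symmetric [of n] by (simp add: algebra_simps)
qed

text \<open>The shape of the closed form comes from the generating function: with \<open>L = - ln (1 - x)\<close> the
  square of \<open>(2L - 2x)/(1 - x)\<^sup>2\<close> has the leading term \<open>4L\<^sup>2/(1 - x)\<^sup>4\<close>, whose coefficients involve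
  \<open>H\<^sub>1\<^sup>2 - H\<^sub>2\<close> with a cubic factor.\<close>

lemma quicksort_mean_convolution_eq:
  "quicksort_mean_convolution n =
     2 / 3 * (real n + 1) * (real n + 2) * (real n + 3) * ((harmonic 1 n)\<^sup>2 - harmonic 2 n)
       - (122 / 9 * real n + 44 / 3 * (real n)\<^sup>2 + 34 / 9 * (real n) ^ 3) * harmonic 1 n
       + 257 / 27 * real n + 146 / 9 * (real n)\<^sup>2 + 169 / 27 * (real n) ^ 3"
proof (induction n)
  case 0
  then show ?case
    by (simp add: quicksort_mean_convolution_def quicksort_mean_def)
next
  case (Suc n)
  let ?R = "\<lambda>n. 2 / 3 * (real n + 1) * (real n + 2) * (real n + 3) * ((harmonic 1 n)\<^sup>2 - harmonic 2 n)
       - (122 / 9 * real n + 44 / 3 * (real n)\<^sup>2 + 34 / 9 * (real n) ^ 3) * harmonic 1 n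
       + 257 / 27 * real n + 146 / 9 * (real n)\<^sup>2 + 169 / 27 * (real n) ^ 3"
  \<comment> \<open>With \<open>n + 1\<close> as a variable of its own, clearing denominators does not expand it.\<close>
  define x where "x = real n + 1"
  have n: "real n = x - 1" and "x \<noteq> 0"
    by (simp_all add: x_def)
  have "x * quicksort_mean_convolution (Suc n) =
     (x + 3) * ?R n + 4 * (real n * (real n + 1) * (real n + 2) / 3 * harmonic 1 n
       + real n / 9 - 7 * (real n)\<^sup>2 / 6 - 17 * (real n) ^ 3 / 18)"
    using quicksort_mean_convolution_Suc [of n]
    unfolding Suc.IH weighted_sum_quicksort_mean x_def by (simp add: add.assoc)
  also have "\<dots> = x * ?R (Suc n)"
    using \<open>x \<noteq> 0\<close> unfolding harmonic_Suc of_nat_Suc n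
    by (simp add: field_simps power2_eq_square power3_eq_cube)
  finally show ?case
    using \<open>x \<noteq> 0\<close> by simp
qed

definition quicksort_variance :: "nat \<Rightarrow> real" where
  "quicksort_variance n =
     real n * (7 * real n + 13) - 2 * (real n + 1) * harmonic 1 n
       - 4 * (real n + 1)\<^sup>2 * harmonic 2 n"

text \<open>The second factorial moment in the binomial normalisation \<open>E[C choose 2]\<close>.\<close>

definition quicksort_second_moment :: "nat \<Rightarrow> real" where
  "quicksort_second_moment n =
     (quicksort_variance n + (quicksort_mean n)\<^sup>2 - quicksort_mean n) / 2"

text \<open>This is the Quicksort recursion for \<open>E[C choose 2]\<close>, solved for the terms that are sums over
  the shorter lengths. In this form it can be proved by induction, because increasing \<open>n\<close> adds a
  single term to the sum and every other quantity has a closed form.\<close>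

lemma sum_quicksort_second_moment:
  "2 * (\<Sum>k<Suc n. quicksort_second_moment k) + quicksort_mean_convolution n =
     (real n + 1) * quicksort_second_moment (Suc n) - (real n + 1) * real n * (real n - 1) / 2
       - (real n + 1) * real n * (quicksort_mean (Suc n) - real n)"
proof (induction n)
  case 0
  then show ?case
    by (simp add: quicksort_mean_convolution_def quicksort_second_moment_def
        quicksort_variance_def quicksort_mean_def)
next
  case (Suc n)
  define x where "x = real n + 1"
  have n: "real n = x - 1" and "x > 0"
    by (simp_all add: x_def)
  have "2 * quicksort_second_moment (Suc n)
      + quicksort_mean_convolution (Suc n) - quicksort_mean_convolution n =
     ((x + 1) * quicksort_second_moment (Suc (Suc n)) - (x + 1) * x * (x - 1) / 2
        - (x + 1) * x * (quicksort_mean (Suc (Suc n)) - x))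
     - (x * quicksort_second_moment (Suc n) - x * (x - 1) * (x - 2) / 2
        - x * (x - 1) * (quicksort_mean (Suc n) - (x - 1)))"
  proof -
    define h where "h = harmonic 1 n"
    define g where "g = harmonic 2 n"
    define y where "y = 1 / x"
    define z where "z = 1 / (x + 1)"
    \<comment> \<open>As rewrite rules these equations are partial fractions: they remove all mixed products of
      \<open>x\<close>, \<open>y\<close> and \<open>z\<close>, so that the identity reduces to a comparison of coefficients.\<close>
    have reciprocals: "x * y = 1" "x * z = 1 - z" "y * z = y - z"
      using \<open>x > 0\<close> by (simp_all add: y_def z_def field_simps)
    have cancel: "x * (y * w) = w" "x * (z * w) = w - z * w"
      "y * (z * w) = y * w - z * w" for w
      by (simp_all only: mult.assoc [symmetric] reciprocals left_diff_distrib mult_1_left)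
    have harmonic: "harmonic 1 (Suc n) = h + y" "harmonic 2 (Suc n) = g + y * y"
      "harmonic 1 (Suc (Suc n)) = h + y + z" "harmonic 2 (Suc (Suc n)) = g + y * y + z * z"
      by (simp_all add: h_def g_def y_def z_def x_def power2_eq_square add.commute)
    show ?thesis
      unfolding quicksort_mean_convolution_eq quicksort_second_moment_def quicksort_variance_def
        quicksort_mean_def harmonic h_def [symmetric] g_def [symmetric] of_nat_Suc n
      by (simp add: field_split_simps eval_nat_numeral)
        (simp add: algebra_simps reciprocals cancel)
  qed
  then show ?case
    using Suc.IH by (simp add: x_def algebra_simps)
qed

lemma quicksort_summand_coeffs:
  fixes A B :: "real fps"
  assumes "fps_nth A 0 = 1" "fps_nth B 0 = 1"
  shows "fps_nth ((1 + fps_X) ^ m * A * B) 0 = 1"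
    and "fps_nth ((1 + fps_X) ^ m * A * B) 1 = real m + fps_nth A 1 + fps_nth B 1"
    and "fps_nth ((1 + fps_X) ^ m * A * B) 2 =
           real m * (real m - 1) / 2 + real m * (fps_nth A 1 + fps_nth B 1)
             + fps_nth A 2 + fps_nth B 2 + fps_nth A 1 * fps_nth B 1"
proof -
  have coeff: "fps_nth ((1 + fps_X) ^ m :: real fps) k = real (m choose k)" for k
    by (simp add: fps_binomial_of_nat [symmetric] binomial_gbinomial)
  have "real (m choose 2) = real m * (real m - 1) / 2"
    by (cases m) (auto simp: choose_two real_of_nat_div algebra_simps)
  then show "fps_nth ((1 + fps_X) ^ m * A * B) 2 =
           real m * (real m - 1) / 2 + real m * (fps_nth A 1 + fps_nth B 1)
             + fps_nth A 2 + fps_nth B 2 + fps_nth A 1 * fps_nth B 1"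
    using assms by (simp add: fps_mult_nth coeff numeral_2_eq_2) (simp add: algebra_simps)
  show "fps_nth ((1 + fps_X) ^ m * A * B) 0 = 1"
    and "fps_nth ((1 + fps_X) ^ m * A * B) 1 = real m + fps_nth A 1 + fps_nth B 1"
    using assms by (simp_all add: fps_mult_nth coeff)
qed

text \<open>Comparing coefficients in the Quicksort recursion gives recursions for the first two factorial
  moments. They determine the moments, and the closed forms satisfy them.\<close>

lemma quicksort_series_coeffs:
  "fps_nth (quicksort_series n) 0 = 1 \<and> fps_nth (quicksort_series n) 1 = quicksort_mean n
     \<and> fps_nth (quicksort_series n) 2 = quicksort_second_moment n"
proof (induction n rule: less_induct)
  case (less n)
  show ?case
  proof (cases n)
    case 0
    then show ?thesis
      by (simp add: quicksort_mean_def quicksort_second_moment_def quicksort_variance_def)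
  next
    case (Suc m)
    let ?Q = quicksort_series and ?M = quicksort_mean and ?W = quicksort_second_moment
    have IH: "fps_nth (?Q k) 0 = 1" "fps_nth (?Q k) 1 = ?M k" "fps_nth (?Q k) 2 = ?W k"
      if "k \<le> m" for k
      using less [of k] that Suc by auto
    have reflect: "(\<Sum>k\<le>m. f (m - k)) = (\<Sum>k\<le>m. f k)" for f :: "nat \<Rightarrow> real"
      by (rule sum.reindex_bij_witness [where i = "\<lambda>k. m - k" and j = "\<lambda>k. m - k"]) auto
    have rec: "(real m + 1) * fps_nth (?Q (Suc m)) i =
            (\<Sum>k\<le>m. fps_nth ((1 + fps_X) ^ m * ?Q k * ?Q (m - k)) i)" for i
      using arg_cong [OF quicksort_series_rec [of "Suc m"], of "\<lambda>F. fps_nth F i"]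
      by (simp add: fps_sum_nth lessThan_Suc_atMost fps_of_nat [symmetric] add.commute
          del: of_nat_Suc) simp
    have "(real m + 1) * fps_nth (?Q (Suc m)) 0 = (\<Sum>k\<le>m. 1)"
      unfolding rec
      by (intro sum.cong) (simp_all only: quicksort_summand_coeffs(1) IH atMost_iff diff_le_self)
    then have "(real m + 1) * fps_nth (?Q (Suc m)) 0 = (real m + 1) * 1"
      by simp
    moreover have "(real m + 1) * fps_nth (?Q (Suc m)) 1 = (real m + 1) * ?M (Suc m)"
    proof -
      have "(real m + 1) * fps_nth (?Q (Suc m)) 1 = (\<Sum>k\<le>m. real m + ?M k + ?M (m - k))"
        unfolding rec by (intro sum.cong) (simp_all only: quicksort_summand_coeffs(2) IH atMost_iff diff_le_self)
      also have "\<dots> = (real m + 1) * real m + 2 * (\<Sum>k\<le>m. ?M k)"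
        by (simp add: sum.distrib reflect [of ?M])
      finally show ?thesis
        using sum_quicksort_mean [of "Suc m"]
        by (simp add: lessThan_Suc_atMost algebra_simps)
    qed
    moreover have "(real m + 1) * fps_nth (?Q (Suc m)) 2 = (real m + 1) * ?W (Suc m)"
    proof -
      have "(real m + 1) * fps_nth (?Q (Suc m)) 2 =
          (\<Sum>k\<le>m. real m * (real m - 1) / 2 + real m * (?M k + ?M (m - k))
             + ?W k + ?W (m - k) + ?M k * ?M (m - k))"
        unfolding rec by (intro sum.cong) (simp_all only: quicksort_summand_coeffs(3) IH atMost_iff diff_le_self)
      also have "\<dots> = (real m + 1) * real m * (real m - 1) / 2 + real m * (2 * (\<Sum>k\<le>m. ?M k))
          + 2 * (\<Sum>k\<le>m. ?W k) + quicksort_mean_convolution m"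
        by (simp add: sum.distrib reflect [of ?M] reflect [of ?W] quicksort_mean_convolution_def
            flip: sum_distrib_left)
      also have "2 * (\<Sum>k\<le>m. ?M k) = (real m + 1) * (?M (Suc m) - real m)"
        using sum_quicksort_mean [of "Suc m"] by (simp add: lessThan_Suc_atMost add.commute)
      finally show ?thesis
        using sum_quicksort_second_moment [of m]
        by (simp add: lessThan_Suc_atMost algebra_simps)
    qed
    moreover have "real m + 1 \<noteq> 0"
      by simp
    ultimately show ?thesis
      using Suc by (simp only: mult_cancel_left) simp
  qed
qed


section \<open>The variance\<close>

theorem theorem4p19:
  fixes xs :: "'a::linorder list" and n :: nat
  assumes "n \<ge> 1" and "distinct xs" and "length xs = n"
  shows "measure_pmf.variance (dual_pivot_comparisons xs) real =
           real n * (7 * real n + 13) - 2 * (real n + 1) * harmonic 1 n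
             - 4 * (real n + 1)\<^sup>2 * harmonic 2 n"
proof -
  have "measure_pmf.variance (dual_pivot_comparisons xs) real = quicksort_variance n"
    using assms quicksort_series_coeffs [of n]
    by (simp add: variance_factorial_moment_series finite_set_dual_pivot_comparisons
        factorial_moment_series_dual_pivot quicksort_second_moment_def)
  then show ?thesis
    by (simp add: quicksort_variance_def)
qed

end
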